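(* Let $M$ be a regular abelian monoid satisfying the embedding condition. Then there exist a semilattice $\Lambda$, an abelian group $G$, and subgroups $G_e\subseteq G$ for all $e\in\Lambda$ such that (a) $G=\bigcup_{e\in\Lambda}G_e$; (b) $G_e\subseteq G_f$ for all $e\leq f$ in $\Lambda$; (c) $M$ is isomorphic to the submonoid $\bigsqcup_{e\in\Lambda}(\{e\}\times G_e)\subseteq\Lambda\times G$. Moreover, for these data, the monoid $M$ is a refinement monoid if and only if the following three conditions hold: (a$'$) $\Lambda$ is distributive; (b$'$) $G_e+G_f=G_{e+f}$ for all $e,f\in\Lambda$; (c$'$) $G_e\cap G_f=\bigcup_{g\in\Lambda,\ g\leq e,f}G_g$ for all $e,f\in\Lambda$. Furthermore, $M$ is conical if and only if (d$'$) $G_0=\{0\}$; and $M$ satisfies the purity condition if and only if (e$'$) $G_e$ is a pure subgroup of $G$ for all $e\in\Lambda$.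
   Context: All monoids are abelian, written additively with identity $0$. The algebraic preorder on $M$ is: $x\leq y$ iff $x+z=y$ for some $z\in M$. $M$ is regular if $2x\leq x$ for all $x\in M$. $M$ is conical if $x+y=0$ implies $x=y=0$. $M$ is a refinement monoid if whenever $x_1+x_2=y_1+y_2$ in $M$, there are $z_{ij}\in M$ ($i,j\in\{1,2\}$) with $x_i=z_{i1}+z_{i2}$ and $y_j=z_{1j}+z_{2j}$ for all $i,j$. A semilattice is an abelian monoid in which $2x=x$ for all $x$ (equivalently, a join-semilattice with least element $0$ and $+=\vee$; its algebraic preorder is the semilattice order); it is distributive if it is a refinement monoid. An idempotent of $M$ is an $e\in M$ with $2e=e$. For an idempotent $e$, $G_M[e]=\{x\in M\mid e\leq x\leq e\}$, an abelian group under $+$ with identity $e$. A regular abelian monoid $M$ satisfies the embedding condition if for all idempotents $e\leq f$ in $M$ the homomorphism $G_M[e]\to G_M[f]$, $x\mapsto x+f$, is injective; it satisfies the purity condition if for all idempotents $e\leq f$ in $M$ the group $G_M[e]+f=\{x+f\mid x\in G_M[e]\}$ is a pure subgroup of $G_M[f]$. A subgroup $H$ of an abelian group $G$ is pure if $nG\cap H=nH$ for all positive integers $n$. $\Lambda\times G$ is the product monoid with componentwise addition. *)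

theory Defs
  imports "HOL-Algebra.Algebra"
begin

text \<open>
  Abelian monoids are rendered as \<^locale>\<open>comm_monoid\<close> structures of HOL-Algebra. The notation
  is therefore multiplicative: \<open>\<otimes>\<close> stands for the addition of the mathematical text, \<open>\<one>\<close> for its
  zero, and \<open>x [^] n\<close> for the multiple \<open>n x\<close>.
\<close>

definition alg_le :: "('a, 'b) monoid_scheme \<Rightarrow> 'a \<Rightarrow> 'a \<Rightarrow> bool" where
  "alg_le M x y \<longleftrightarrow> x \<in> carrier M \<and> (\<exists>z\<in>carrier M. x \<otimes>\<^bsub>M\<^esub> z = y)"

definition regular_monoid :: "('a, 'b) monoid_scheme \<Rightarrow> bool" where
  "regular_monoid M \<longleftrightarrow> comm_monoid M \<and> (\<forall>x\<in>carrier M. alg_le M (x \<otimes>\<^bsub>M\<^esub> x) x)"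

definition conical_monoid :: "('a, 'b) monoid_scheme \<Rightarrow> bool" where
  "conical_monoid M \<longleftrightarrow> comm_monoid M \<and>
     (\<forall>x\<in>carrier M. \<forall>y\<in>carrier M. x \<otimes>\<^bsub>M\<^esub> y = \<one>\<^bsub>M\<^esub> \<longrightarrow> x = \<one>\<^bsub>M\<^esub> \<and> y = \<one>\<^bsub>M\<^esub>)"

definition refinement_monoid :: "('a, 'b) monoid_scheme \<Rightarrow> bool" where
  "refinement_monoid M \<longleftrightarrow> comm_monoid M \<and>
     (\<forall>x1\<in>carrier M. \<forall>x2\<in>carrier M. \<forall>y1\<in>carrier M. \<forall>y2\<in>carrier M.
        x1 \<otimes>\<^bsub>M\<^esub> x2 = y1 \<otimes>\<^bsub>M\<^esub> y2 \<longrightarrow>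
        (\<exists>z11\<in>carrier M. \<exists>z12\<in>carrier M. \<exists>z21\<in>carrier M. \<exists>z22\<in>carrier M.
           x1 = z11 \<otimes>\<^bsub>M\<^esub> z12 \<and> x2 = z21 \<otimes>\<^bsub>M\<^esub> z22 \<and>
           y1 = z11 \<otimes>\<^bsub>M\<^esub> z21 \<and> y2 = z12 \<otimes>\<^bsub>M\<^esub> z22))"

definition semilattice_monoid :: "('a, 'b) monoid_scheme \<Rightarrow> bool" where
  "semilattice_monoid L \<longleftrightarrow> comm_monoid L \<and> (\<forall>x\<in>carrier L. x \<otimes>\<^bsub>L\<^esub> x = x)"

definition distributive_semilattice :: "('a, 'b) monoid_scheme \<Rightarrow> bool" where
  "distributive_semilattice L \<longleftrightarrow> semilattice_monoid L \<and> refinement_monoid L"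

definition idempotents :: "('a, 'b) monoid_scheme \<Rightarrow> 'a set" where
  "idempotents M = {e \<in> carrier M. e \<otimes>\<^bsub>M\<^esub> e = e}"

text \<open>The group \<open>G\<^sub>M[e]\<close>; its identity element is \<open>e\<close>, not that of \<open>M\<close>.\<close>

definition idem_group :: "('a, 'b) monoid_scheme \<Rightarrow> 'a \<Rightarrow> ('a, 'b) monoid_scheme" where
  "idem_group M e = M\<lparr>carrier := {x \<in> carrier M. alg_le M e x \<and> alg_le M x e}, one := e\<rparr>"

definition pure_subgroup :: "'a set \<Rightarrow> ('a, 'b) monoid_scheme \<Rightarrow> bool" where
  "pure_subgroup H G \<longleftrightarrow> subgroup H G \<and>
     (\<forall>n::nat. n > 0 \<longrightarrow>
        (\<lambda>x. x [^]\<^bsub>G\<^esub> n) ` carrier G \<inter> H = (\<lambda>x. x [^]\<^bsub>G\<^esub> n) ` H)"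

definition embedding_condition :: "('a, 'b) monoid_scheme \<Rightarrow> bool" where
  "embedding_condition M \<longleftrightarrow>
     (\<forall>e\<in>idempotents M. \<forall>f\<in>idempotents M. alg_le M e f \<longrightarrow>
        inj_on (\<lambda>x. x \<otimes>\<^bsub>M\<^esub> f) (carrier (idem_group M e)))"

definition purity_condition :: "('a, 'b) monoid_scheme \<Rightarrow> bool" where
  "purity_condition M \<longleftrightarrow>
     (\<forall>e\<in>idempotents M. \<forall>f\<in>idempotents M. alg_le M e f \<longrightarrow>
        pure_subgroup ((\<lambda>x. x \<otimes>\<^bsub>M\<^esub> f) ` carrier (idem_group M e)) (idem_group M f))"

text \<open>
  The disjoint union of the sets \<open>{e} \<times> G\<^sub>e\<close> is the dependent sum \<^const>\<open>Sigma\<close>, a subset of the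
  carrier of the product monoid. An isomorphism in the sense of \<^const>\<open>iso\<close> is a bijective
  multiplicative map; between monoids it automatically preserves the identity.
\<close>

definition fibred_submonoid ::
    "('l, 'b) monoid_scheme \<Rightarrow> ('g, 'c) monoid_scheme \<Rightarrow> ('l \<Rightarrow> 'g set) \<Rightarrow> ('l \<times> 'g) monoid" where
  "fibred_submonoid L G H = (L \<times>\<times> G)\<lparr>carrier := Sigma (carrier L) H\<rparr>"

definition semilattice_group_data ::
    "('m, 'a) monoid_scheme \<Rightarrow> ('l, 'b) monoid_scheme \<Rightarrow> ('g, 'c) monoid_scheme
      \<Rightarrow> ('l \<Rightarrow> 'g set) \<Rightarrow> bool" where
  "semilattice_group_data M L G H \<longleftrightarrow>
     semilattice_monoid L \<and> comm_group G \<and> (\<forall>e\<in>carrier L. subgroup (H e) G) \<and>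
     carrier G = (\<Union>e\<in>carrier L. H e) \<and>
     (\<forall>e\<in>carrier L. \<forall>f\<in>carrier L. alg_le L e f \<longrightarrow> H e \<subseteq> H f) \<and>
     submonoid (Sigma (carrier L) H) (L \<times>\<times> G) \<and>
     M \<cong> fibred_submonoid L G H"

end

theory Submission
  imports Defs
begin

text \<open>
  Regularity places every element \<open>x\<close> in exactly one group \<open>G\<^sub>M[e]\<close>, so \<open>x \<mapsto> e\<close> is a homomorphism onto
  the semilattice of idempotents. Identifying \<open>x\<close> and \<open>y\<close> when \<open>x + f = y + f\<close> for some idempotent
  \<open>f\<close> yields the maximal group image \<open>G\<close> of \<open>M\<close> (the direct limit of the groups \<open>G\<^sub>M[e]\<close>), and the embedding
  condition says exactly that each \<open>G\<^sub>M[e]\<close> maps injectively to \<open>G\<close>; hence \<open>x\<close> is recovered from \<open>e\<close>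
  and its class. The equivalences are isomorphism invariant and are checked on the
  submonoid of \<open>\<Lambda> \<times> G\<close>.
\<close>

section \<open>Idempotents and their groups\<close>

context comm_monoid
begin

section \<open>The algebraic preorder\<close>

lemma alg_leI: "x \<in> carrier G \<Longrightarrow> z \<in> carrier G \<Longrightarrow> x \<otimes> z = y \<Longrightarrow> alg_le G x y"
  by (auto simp: alg_le_def)

lemma alg_leE:
  assumes "alg_le G x y"
  obtains z where "z \<in> carrier G" "x \<otimes> z = y"
  using assms by (auto simp: alg_le_def)

lemma alg_le_closed: "alg_le G x y \<Longrightarrow> x \<in> carrier G" "alg_le G x y \<Longrightarrow> y \<in> carrier G"
  by (auto simp: alg_le_def)

lemma alg_le_refl: "x \<in> carrier G \<Longrightarrow> alg_le G x x"
  by (rule alg_leI[of _ \<one>]) auto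

lemma alg_le_mult_left: "x \<in> carrier G \<Longrightarrow> y \<in> carrier G \<Longrightarrow> alg_le G x (x \<otimes> y)"
  by (rule alg_leI) auto

lemma alg_le_mult_right: "x \<in> carrier G \<Longrightarrow> y \<in> carrier G \<Longrightarrow> alg_le G y (x \<otimes> y)"
  using alg_le_mult_left[of y x] by (simp add: m_comm)

lemma alg_le_trans:
  assumes "alg_le G x y" "alg_le G y z"
  shows "alg_le G x z"
proof -
  obtain u v where "u \<in> carrier G" "x \<otimes> u = y" "v \<in> carrier G" "y \<otimes> v = z"
    using assms by (auto simp: alg_le_def)
  then show ?thesis
    using alg_le_closed(1)[OF assms(1)] by (intro alg_leI[of _ "u \<otimes> v"]) (auto simp: m_assoc[symmetric])
qed

lemma mult_mult_swap:
  "\<lbrakk>a \<in> carrier G; b \<in> carrier G; c \<in> carrier G; d \<in> carrier G\<rbrakk> \<Longrightarrow>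
    (a \<otimes> b) \<otimes> (c \<otimes> d) = (a \<otimes> c) \<otimes> (b \<otimes> d)"
  by (simp add: m_ac)

lemma idem_alg_le_iff:
  assumes "e \<otimes> e = e" "e \<in> carrier G" "x \<in> carrier G"
  shows "alg_le G e x \<longleftrightarrow> e \<otimes> x = x"
proof
  assume "alg_le G e x"
  then obtain z where "z \<in> carrier G" "e \<otimes> z = x" by (rule alg_leE)
  then show "e \<otimes> x = x" using assms m_assoc[of e e z] by auto
next
  assume "e \<otimes> x = x"
  with assms(2,3) show "alg_le G e x" by (rule alg_leI)
qed

section \<open>The groups attached to idempotents\<close>

lemma idempotents_mult:
  "e \<in> idempotents G \<Longrightarrow> f \<in> idempotents G \<Longrightarrow> e \<otimes> f \<in> idempotents G"
  using mult_mult_swap[of e f e f] by (auto simp: idempotents_def)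

text \<open>Since an idempotent lies below exactly the elements that absorb it, membership becomes
  equational: x absorbs e, and x has a complement adding up to e. Later proofs use this form instead
  of the preorder.\<close>

lemma mem_idem_group_iff:
  assumes "e \<in> idempotents G"
  shows "x \<in> carrier (idem_group G e) \<longleftrightarrow>
    x \<in> carrier G \<and> e \<otimes> x = x \<and> (\<exists>z\<in>carrier G. x \<otimes> z = e)"
proof -
  have "alg_le G e x \<longleftrightarrow> e \<otimes> x = x" if "x \<in> carrier G"
    using assms that by (intro idem_alg_le_iff) (auto simp: idempotents_def)
  then have "x \<in> carrier (idem_group G e) \<longleftrightarrow> x \<in> carrier G \<and> e \<otimes> x = x \<and> alg_le G x e"
    by (auto simp: idem_group_def)
  then show ?thesis by (simp add: alg_le_def conj_ac cong: conj_cong)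
qed

text \<open>Absorption and complements both add componentwise. This yields closure of each group,
  well-definedness of translation by a larger idempotent, and later the compatibility of
  \<open>idem_part\<close> with the operation.\<close>

lemma idem_group_mult:
  assumes "e \<in> idempotents G" "f \<in> idempotents G"
    and "x \<in> carrier (idem_group G e)" "y \<in> carrier (idem_group G f)"
  shows "x \<otimes> y \<in> carrier (idem_group G (e \<otimes> f))"
proof -
  obtain u v where uv: "u \<in> carrier G" "x \<otimes> u = e" "v \<in> carrier G" "y \<otimes> v = f"
    using assms(3,4) unfolding mem_idem_group_iff[OF assms(1)] mem_idem_group_iff[OF assms(2)] by blast
  have xy: "x \<in> carrier G" "y \<in> carrier G" "e \<otimes> x = x" "f \<otimes> y = y"
    using assms(3,4) unfolding mem_idem_group_iff[OF assms(1)] mem_idem_group_iff[OF assms(2)] by auto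
  have ef: "e \<in> carrier G" "f \<in> carrier G" using assms by (auto simp: idempotents_def)
  have "(e \<otimes> f) \<otimes> (x \<otimes> y) = (e \<otimes> x) \<otimes> (f \<otimes> y)"
    using xy(1,2) ef by (simp add: mult_mult_swap)
  moreover have "(x \<otimes> y) \<otimes> (u \<otimes> v) = (x \<otimes> u) \<otimes> (y \<otimes> v)"
    using xy(1,2) uv(1,3) by (simp add: mult_mult_swap)
  ultimately show ?thesis
    unfolding mem_idem_group_iff[OF idempotents_mult[OF assms(1,2)]] using uv xy by auto
qed

lemma idem_in_idem_group: "e \<in> idempotents G \<Longrightarrow> e \<in> carrier (idem_group G e)"
  unfolding mem_idem_group_iff by (auto simp: idempotents_def)

text \<open>A complement z of x in the whole monoid may lie outside the group; e + z absorbs e and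
  is still a complement.\<close>

lemma idem_group_inverse:
  assumes "e \<in> idempotents G" "x \<in> carrier (idem_group G e)"
  obtains z where "z \<in> carrier (idem_group G e)" "x \<otimes> z = e"
proof -
  have e: "e \<in> carrier G" "e \<otimes> e = e" using assms by (auto simp: idempotents_def)
  obtain z where z: "z \<in> carrier G" "x \<otimes> z = e"
    using assms(2) unfolding mem_idem_group_iff[OF assms(1)] by blast
  have x: "x \<in> carrier G" "e \<otimes> x = x" using assms(2) unfolding mem_idem_group_iff[OF assms(1)] by auto
  have "x \<otimes> (e \<otimes> z) = e" using x z e m_lcomm[of x e z] by simp
  moreover have "e \<otimes> (e \<otimes> z) = e \<otimes> z" using e z by (simp add: m_assoc[symmetric])
  moreover have "(e \<otimes> z) \<otimes> x = e" using calculation(1) x(1) z(1) e(1) m_comm[of "e \<otimes> z" x] by simp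
  ultimately have "e \<otimes> z \<in> carrier (idem_group G e)"
    unfolding mem_idem_group_iff[OF assms(1)] using x z(1) e by auto
  then show ?thesis using that \<open>x \<otimes> (e \<otimes> z) = e\<close> by blast
qed

lemma comm_group_idem_group:
  assumes "e \<in> idempotents G"
  shows "comm_group (idem_group G e)"
proof (rule comm_groupI)
  have mult: "x \<otimes>\<^bsub>idem_group G e\<^esub> y = x \<otimes> y" for x y
    by (simp add: idem_group_def)
  have ee: "e \<otimes> e = e" using assms by (auto simp: idempotents_def)
  have sub: "x \<in> carrier G" if "x \<in> carrier (idem_group G e)" for x
    using that by (auto simp: idem_group_def)
  fix x y assume x: "x \<in> carrier (idem_group G e)" and y: "y \<in> carrier (idem_group G e)"
  show "x \<otimes>\<^bsub>idem_group G e\<^esub> y \<in> carrier (idem_group G e)"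
    using idem_group_mult[OF assms assms x y] ee mult by simp
  show "x \<otimes>\<^bsub>idem_group G e\<^esub> y = y \<otimes>\<^bsub>idem_group G e\<^esub> x"
    using x y sub by (simp add: mult m_comm)
  fix z assume z: "z \<in> carrier (idem_group G e)"
  show "x \<otimes>\<^bsub>idem_group G e\<^esub> y \<otimes>\<^bsub>idem_group G e\<^esub> z = x \<otimes>\<^bsub>idem_group G e\<^esub> (y \<otimes>\<^bsub>idem_group G e\<^esub> z)"
    using x y z sub by (simp add: mult m_assoc)
next
  show "\<one>\<^bsub>idem_group G e\<^esub> \<in> carrier (idem_group G e)"
    using idem_in_idem_group[OF assms] by (simp add: idem_group_def)
  fix x assume x: "x \<in> carrier (idem_group G e)"
  show "\<one>\<^bsub>idem_group G e\<^esub> \<otimes>\<^bsub>idem_group G e\<^esub> x = x"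
    using x mem_idem_group_iff[OF assms] by (simp add: idem_group_def)
  obtain z where z: "z \<in> carrier (idem_group G e)" "x \<otimes> z = e"
    using idem_group_inverse[OF assms x] by blast
  then have "z \<otimes> x = e"
    using x m_comm by (auto simp: idem_group_def)
  then show "\<exists>y\<in>carrier (idem_group G e). y \<otimes>\<^bsub>idem_group G e\<^esub> x = \<one>\<^bsub>idem_group G e\<^esub>"
    using z by (auto simp: idem_group_def)
qed

text \<open>The restriction to positive n matters: for n = 0 the left side is e, while the right
  side is the identity of the monoid.\<close>

lemma idem_group_pow:
  assumes "e \<in> idempotents G" "x \<in> carrier (idem_group G e)" "n > (0::nat)"
  shows "x [^]\<^bsub>idem_group G e\<^esub> n = x [^] n"
  using assms(3)
proof (induction n)
  case (Suc n)
  show ?case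
  proof (cases "n = 0")
    case True
    then show ?thesis
      using assms mem_idem_group_iff[OF assms(1)] by (auto simp: nat_pow_def idem_group_def)
  next
    case False
    then show ?thesis using Suc by (simp add: nat_pow_def) (simp add: idem_group_def)
  qed
qed simp

lemma idem_pow: "f \<in> idempotents G \<Longrightarrow> n > (0::nat) \<Longrightarrow> f [^] n = f"
proof (induction n)
  case (Suc n)
  then show ?case by (cases "n = 0") (auto simp: idempotents_def)
qed simp

text \<open>Translation by f is a group homomorphism, so its image is a subgroup and one inclusion
  in the purity equation is automatic. The other inclusion is restated with powers of the ambient
  monoid, using that a positive multiple of f is f. The resulting statement mentions the groups only
  through their carriers.\<close>

lemma pure_idem_group_iff:
  assumes e: "e \<in> idempotents G" and f: "f \<in> idempotents G" and le: "alg_le G e f"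
  shows "pure_subgroup ((\<lambda>x. x \<otimes> f) ` carrier (idem_group G e)) (idem_group G f) \<longleftrightarrow>
    (\<forall>n>0. \<forall>x\<in>carrier (idem_group G f). \<forall>y\<in>carrier (idem_group G e).
       x [^] (n::nat) = y \<otimes> f \<longrightarrow> (\<exists>z\<in>carrier (idem_group G e). y \<otimes> f = z [^] n \<otimes> f))"
    (is "?L \<longleftrightarrow> ?R")
proof -
  let ?E = "carrier (idem_group G e)" and ?F = "carrier (idem_group G f)"
  let ?h = "\<lambda>x. x \<otimes> f"
  have ef: "e \<otimes> f = f"
    using le e f idem_alg_le_iff by (auto simp: idempotents_def)
  have fc: "f \<in> carrier G" "f \<otimes> f = f" using f by (auto simp: idempotents_def)
  have Ec: "x \<in> carrier G" if "x \<in> ?E" for x using that by (auto simp: idem_group_def)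
  have hF: "?h x \<in> ?F" if "x \<in> ?E" for x
    using idem_group_mult[OF e f that idem_in_idem_group[OF f]] ef by simp
  have hom: "?h \<in> hom (idem_group G e) (idem_group G f)"
  proof (rule homI)
    fix x y assume "x \<in> ?E" "y \<in> ?E"
    then have "x \<otimes> y \<otimes> f = x \<otimes> y \<otimes> (f \<otimes> f)" "x \<in> carrier G" "y \<in> carrier G"
      using Ec fc by auto
    then have "x \<otimes> y \<otimes> f = (x \<otimes> f) \<otimes> (y \<otimes> f)" using fc(1) mult_mult_swap[of x y f f] by simp
    then show "x \<otimes>\<^bsub>idem_group G e\<^esub> y \<otimes> f = x \<otimes> f \<otimes>\<^bsub>idem_group G f\<^esub> (y \<otimes> f)"
      by (simp add: idem_group_def)
  qed (use hF in auto)
  interpret group_hom "idem_group G e" "idem_group G f" ?h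
    using comm_group_idem_group e f hom
    by (auto simp: group_hom_def group_hom_axioms_def comm_group_def)
  have "subgroup (?h ` ?E) (idem_group G f)" by (rule img_is_subgroup)
  moreover have pow: "?h z [^]\<^bsub>idem_group G f\<^esub> n = z [^] n \<otimes> f" if "z \<in> ?E" "n > 0" for z and n :: nat
    using that idem_group_pow[OF f hF] Ec fc idem_pow[OF f] by (simp add: nat_pow_distrib)
  moreover have "(\<lambda>x. x [^]\<^bsub>idem_group G f\<^esub> n) ` (?h ` ?E) \<subseteq> (\<lambda>x. x [^]\<^bsub>idem_group G f\<^esub> n) ` ?F \<inter> ?h ` ?E"
    for n :: nat
  proof
    fix w assume "w \<in> (\<lambda>x. x [^]\<^bsub>idem_group G f\<^esub> n) ` (?h ` ?E)"
    then obtain z where z: "z \<in> ?E" "w = ?h z [^]\<^bsub>idem_group G f\<^esub> n" by auto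
    then have "w = ?h (z [^]\<^bsub>idem_group G e\<^esub> n)" by (simp add: hom_nat_pow)
    then show "w \<in> (\<lambda>x. x [^]\<^bsub>idem_group G f\<^esub> n) ` ?F \<inter> ?h ` ?E"
      using z hF G.nat_pow_closed by blast
  qed
  ultimately have "?L \<longleftrightarrow> (\<forall>n::nat. n > 0 \<longrightarrow>
      (\<lambda>x. x [^]\<^bsub>idem_group G f\<^esub> n) ` ?F \<inter> ?h ` ?E \<subseteq> (\<lambda>x. x [^]\<^bsub>idem_group G f\<^esub> n) ` (?h ` ?E))"
    unfolding pure_subgroup_def by (simp add: set_eq_subset)
  also have "\<dots> \<longleftrightarrow> ?R"
  proof (intro all_cong)
    fix n :: nat assume n: "n > 0"
    have "(\<lambda>x. x [^]\<^bsub>idem_group G f\<^esub> n) ` ?F = (\<lambda>x. x [^] n) ` ?F"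
      using idem_group_pow[OF f _ n] by (intro image_cong) auto
    moreover have "(\<lambda>x. x [^]\<^bsub>idem_group G f\<^esub> n) ` (?h ` ?E) = (\<lambda>z. z [^] n \<otimes> f) ` ?E"
      unfolding image_image using pow[OF _ n] by (intro image_cong) auto
    ultimately show "((\<lambda>x. x [^]\<^bsub>idem_group G f\<^esub> n) ` ?F \<inter> ?h ` ?E
        \<subseteq> (\<lambda>x. x [^]\<^bsub>idem_group G f\<^esub> n) ` (?h ` ?E)) \<longleftrightarrow>
      (\<forall>x\<in>?F. \<forall>y\<in>?E. x [^] n = y \<otimes> f \<longrightarrow> (\<exists>z\<in>?E. y \<otimes> f = z [^] n \<otimes> f))"
      by (auto simp: subset_iff image_iff) metis
  qed
  finally show ?thesis .
qed

lemma purity_condition_iff: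
  "purity_condition G \<longleftrightarrow> (\<forall>e\<in>idempotents G. \<forall>f\<in>idempotents G. alg_le G e f \<longrightarrow>
    (\<forall>n>0. \<forall>x\<in>carrier (idem_group G f). \<forall>y\<in>carrier (idem_group G e).
       x [^] (n::nat) = y \<otimes> f \<longrightarrow> (\<exists>z\<in>carrier (idem_group G e). y \<otimes> f = z [^] n \<otimes> f)))"
  unfolding purity_condition_def using pure_idem_group_iff by auto

end

section \<open>Invariance under isomorphism\<close>

locale comm_monoid_iso = M: comm_monoid M + N: comm_monoid N
  for M :: "('a, 'c) monoid_scheme" and N :: "('b, 'd) monoid_scheme" +
  fixes h
  assumes hom: "h \<in> hom M N" and bij: "bij_betw h (carrier M) (carrier N)"
begin

lemma h_closed [simp]: "x \<in> carrier M \<Longrightarrow> h x \<in> carrier N"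
  and h_mult: "x \<in> carrier M \<Longrightarrow> y \<in> carrier M \<Longrightarrow> h (x \<otimes>\<^bsub>M\<^esub> y) = h x \<otimes>\<^bsub>N\<^esub> h y"
  using hom by (auto simp: hom_mult hom_in_carrier)

lemma h_eq_iff: "x \<in> carrier M \<Longrightarrow> y \<in> carrier M \<Longrightarrow> h x = h y \<longleftrightarrow> x = y"
  using bij by (auto simp: bij_betw_def inj_on_eq_iff)

lemma carrier_image: "carrier N = h ` carrier M"
  using bij by (auto simp: bij_betw_def)

text \<open>A multiplicative map need not preserve the identity; surjectivity supplies a preimage u
  of it, and both identities are then compared through the image of u.\<close>

lemma h_one: "h \<one>\<^bsub>M\<^esub> = \<one>\<^bsub>N\<^esub>"
proof -
  obtain u where u: "u \<in> carrier M" "h u = \<one>\<^bsub>N\<^esub>"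
    using carrier_image N.one_closed by force
  then have "h \<one>\<^bsub>M\<^esub> = h \<one>\<^bsub>M\<^esub> \<otimes>\<^bsub>N\<^esub> h u" by simp
  also have "\<dots> = h (\<one>\<^bsub>M\<^esub> \<otimes>\<^bsub>M\<^esub> u)" using u(1) by (simp only: h_mult M.one_closed)
  finally show ?thesis using u by simp
qed

lemma h_pow: "x \<in> carrier M \<Longrightarrow> h (x [^]\<^bsub>M\<^esub> (n::nat)) = h x [^]\<^bsub>N\<^esub> n"
  by (induction n) (auto simp: h_one h_mult)

lemma h_alg_le: "x \<in> carrier M \<Longrightarrow> y \<in> carrier M \<Longrightarrow> alg_le N (h x) (h y) \<longleftrightarrow> alg_le M x y"
  by (auto simp: alg_le_def carrier_image simp flip: h_mult simp: h_eq_iff)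

lemma h_idempotents: "idempotents N = h ` idempotents M"
  by (auto simp: idempotents_def carrier_image simp flip: h_mult simp: h_eq_iff)

lemma h_idem_group:
  "e \<in> carrier M \<Longrightarrow> carrier (idem_group N (h e)) = h ` carrier (idem_group M e)"
  by (auto simp: idem_group_def carrier_image h_alg_le)

text \<open>Writing the carrier of \<open>N\<close> as the image of \<open>h\<close> turns its
  quantifiers into quantifiers over \<open>M\<close>; each equation then has the form h x = h y, and
  injectivity removes \<open>h\<close>.\<close>

lemma refinement_transfer: "refinement_monoid M \<longleftrightarrow> refinement_monoid N"
  unfolding refinement_monoid_def carrier_image
  using M.comm_monoid_axioms N.comm_monoid_axioms
  by (simp add: h_eq_iff flip: h_mult cong: ball_cong bex_cong)

lemma conical_transfer: "conical_monoid M \<longleftrightarrow> conical_monoid N"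
  unfolding conical_monoid_def carrier_image
  using M.comm_monoid_axioms N.comm_monoid_axioms
  by (simp add: h_eq_iff flip: h_mult h_one cong: ball_cong bex_cong)

text \<open>The same rewriting applies once purity is in the elementwise form of
  \<open>purity_condition_iff\<close>.\<close>

lemma purity_transfer: "purity_condition M \<longleftrightarrow> purity_condition N"
proof -
  have [simp]: "x \<in> carrier M" if "x \<in> idempotents M" for x
    using that by (auto simp: idempotents_def)
  have [simp]: "x \<in> carrier M" if "x \<in> carrier (idem_group M e)" for x e
    using that by (auto simp: idem_group_def)
  show ?thesis
    unfolding M.purity_condition_iff N.purity_condition_iff h_idempotents
    by (simp add: h_idem_group h_alg_le h_eq_iff flip: h_mult h_pow cong: ball_cong bex_cong)
qed

end

section \<open>Semilattices of subgroups\<close>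

text \<open>This is \<open>semilattice_group_data\<close> with the monoid \<open>M\<close> removed:
  the submonoid clause is derived in \<open>submonoid_S\<close>, and the isomorphism is treated
  separately. The three equivalences can thus be proved for \<open>S\<close> alone.\<close>

locale semilattice_of_subgroups = L: comm_monoid L + G: comm_group G
  for L :: "('l, 'c) monoid_scheme" and G :: "('g, 'd) monoid_scheme" +
  fixes H :: "'l \<Rightarrow> 'g set"
  assumes idem: "e \<in> carrier L \<Longrightarrow> e \<otimes>\<^bsub>L\<^esub> e = e"
    and subgroup_H: "e \<in> carrier L \<Longrightarrow> subgroup (H e) G"
    and mono_H: "alg_le L e f \<Longrightarrow> H e \<subseteq> H f"
    and carrier_G: "carrier G = (\<Union>e\<in>carrier L. H e)"
begin

abbreviation "S \<equiv> fibred_submonoid L G H"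

section \<open>Order, idempotents and groups of the fibred monoid\<close>

lemma S_simps [simp]:
  "carrier S = Sigma (carrier L) H"
  "(e, a) \<otimes>\<^bsub>S\<^esub> (f, b) = (e \<otimes>\<^bsub>L\<^esub> f, a \<otimes>\<^bsub>G\<^esub> b)"
  "\<one>\<^bsub>S\<^esub> = (\<one>\<^bsub>L\<^esub>, \<one>\<^bsub>G\<^esub>)"
  by (auto simp: fibred_submonoid_def DirProd_def)

lemma H_carrier: "e \<in> carrier L \<Longrightarrow> a \<in> H e \<Longrightarrow> a \<in> carrier G"
  using subgroup.subset[OF subgroup_H] by blast

lemma H_mult: "e \<in> carrier L \<Longrightarrow> a \<in> H e \<Longrightarrow> b \<in> H e \<Longrightarrow> a \<otimes>\<^bsub>G\<^esub> b \<in> H e"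
  by (rule subgroup.m_closed[OF subgroup_H])

lemma H_inv: "e \<in> carrier L \<Longrightarrow> a \<in> H e \<Longrightarrow> inv\<^bsub>G\<^esub> a \<in> H e"
  by (rule subgroup.m_inv_closed[OF subgroup_H])

lemma H_one: "e \<in> carrier L \<Longrightarrow> \<one>\<^bsub>G\<^esub> \<in> H e"
  by (rule subgroup.one_closed[OF subgroup_H])

lemma H_pow: "e \<in> carrier L \<Longrightarrow> a \<in> H e \<Longrightarrow> a [^]\<^bsub>G\<^esub> (n::nat) \<in> H e"
  by (induction n) (auto simp: H_one H_mult)

lemma H_mono:
  assumes "e \<in> carrier L" "f \<in> carrier L"
  shows "H e \<subseteq> H (e \<otimes>\<^bsub>L\<^esub> f)" "H f \<subseteq> H (e \<otimes>\<^bsub>L\<^esub> f)"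
  using mono_H L.alg_le_mult_left[OF assms] L.alg_le_mult_right[OF assms] by auto

lemma H_mult':
  assumes "e \<in> carrier L" "f \<in> carrier L" "a \<in> H e" "b \<in> H f"
  shows "a \<otimes>\<^bsub>G\<^esub> b \<in> H (e \<otimes>\<^bsub>L\<^esub> f)"
  using assms H_mono[OF assms(1,2)] by (intro H_mult) auto

lemma le_iff: "e \<in> carrier L \<Longrightarrow> f \<in> carrier L \<Longrightarrow> alg_le L e f \<longleftrightarrow> e \<otimes>\<^bsub>L\<^esub> f = f"
  using L.idem_alg_le_iff idem by auto

lemma submonoid_S: "submonoid (Sigma (carrier L) H) (L \<times>\<times> G)"
  by unfold_locales (auto simp: H_mult' H_one H_carrier)

lemma comm_monoid_S: "comm_monoid S"
  by (rule comm_monoidI) (auto simp: H_mult' H_one H_carrier L.m_ac G.m_ac)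

sublocale S: comm_monoid S
  by (rule comm_monoid_S)

text \<open>Idempotency keeps the first coordinate at e as soon as n is positive; for n = 0 it would
  be the zero of the semilattice.\<close>

lemma S_pow: "e \<in> carrier L \<Longrightarrow> a \<in> H e \<Longrightarrow> n > 0 \<Longrightarrow> (e, a) [^]\<^bsub>S\<^esub> (n::nat) = (e, a [^]\<^bsub>G\<^esub> n)"
proof (induction n)
  case (Suc n)
  then show ?case by (cases "n = 0") (auto simp: idem H_carrier)
qed simp

text \<open>The group coordinate imposes no constraint: if e lies below f, then a already belongs to
  \<open>H f\<close>, so the difference b - a is available there as the second coordinate of a
  witness.\<close>

lemma S_alg_le:
  assumes "e \<in> carrier L" "f \<in> carrier L" "a \<in> H e" "b \<in> H f"
  shows "alg_le S (e, a) (f, b) \<longleftrightarrow> alg_le L e f"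
proof
  assume "alg_le S (e, a) (f, b)"
  then obtain z where "z \<in> carrier S" "(e, a) \<otimes>\<^bsub>S\<^esub> z = (f, b)" by (rule S.alg_leE)
  then show "alg_le L e f" using assms(1) by (cases z) (auto intro: L.alg_leI)
next
  assume le: "alg_le L e f"
  have a: "a \<in> H f" "a \<in> carrier G" "b \<in> carrier G"
    using mono_H[OF le] assms H_carrier by auto
  then have "a \<otimes>\<^bsub>G\<^esub> (inv\<^bsub>G\<^esub> a \<otimes>\<^bsub>G\<^esub> b) = b" by (simp flip: G.m_assoc)
  then have "(e, a) \<otimes>\<^bsub>S\<^esub> (f, inv\<^bsub>G\<^esub> a \<otimes>\<^bsub>G\<^esub> b) = (f, b)"
    using le assms le_iff by simp
  then show "alg_le S (e, a) (f, b)"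
    using assms a by (intro S.alg_leI[of _ "(f, inv\<^bsub>G\<^esub> a \<otimes>\<^bsub>G\<^esub> b)"]) (auto intro: H_mult H_inv)
qed

lemma idempotents_S: "idempotents S = (\<lambda>e. (e, \<one>\<^bsub>G\<^esub>)) ` carrier L"
proof -
  have "a = \<one>\<^bsub>G\<^esub>" if "e \<in> carrier L" "a \<in> H e" "a \<otimes>\<^bsub>G\<^esub> a = a" for e a
    using that H_carrier by simp
  then show ?thesis by (auto simp: idempotents_def idem H_one)
qed

text \<open>By \<open>S_alg_le\<close> only first coordinates are compared, and the order of a
  semilattice is antisymmetric.\<close>

lemma idem_group_S: "e \<in> carrier L \<Longrightarrow> carrier (idem_group S (e, \<one>\<^bsub>G\<^esub>)) = {e} \<times> H e"
proof -
  assume e: "e \<in> carrier L"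
  have "f = e" if "f \<in> carrier L" "alg_le L e f" "alg_le L f e" for f
    using that e le_iff L.m_comm by metis
  then show ?thesis
    using e by (auto simp: idem_group_def S_alg_le H_one L.alg_le_refl) metis
qed

text \<open>Over the zero of the semilattice, (0, a) and (0, -a) sum to zero, so conicality kills a.
  Conversely, a zero sum in a semilattice forces both first coordinates to be zero, which places
  both group coordinates in the trivial group.\<close>

lemma conical_S: "conical_monoid S \<longleftrightarrow> H \<one>\<^bsub>L\<^esub> = {\<one>\<^bsub>G\<^esub>}"
proof
  assume con: "conical_monoid S"
  have "a = \<one>\<^bsub>G\<^esub>" if "a \<in> H \<one>\<^bsub>L\<^esub>" for a
  proof -
    have "(\<one>\<^bsub>L\<^esub>, a) \<otimes>\<^bsub>S\<^esub> (\<one>\<^bsub>L\<^esub>, inv\<^bsub>G\<^esub> a) = \<one>\<^bsub>S\<^esub>"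
      using that by (simp add: H_carrier[OF L.one_closed])
    moreover have "(\<one>\<^bsub>L\<^esub>, a) \<in> carrier S" "(\<one>\<^bsub>L\<^esub>, inv\<^bsub>G\<^esub> a) \<in> carrier S"
      using that by (auto intro: H_inv)
    ultimately have "(\<one>\<^bsub>L\<^esub>, a) = \<one>\<^bsub>S\<^esub>"
      using con unfolding conical_monoid_def by blast
    then show ?thesis by simp
  qed
  then show "H \<one>\<^bsub>L\<^esub> = {\<one>\<^bsub>G\<^esub>}" using H_one[OF L.one_closed] by blast
next
  assume H1: "H \<one>\<^bsub>L\<^esub> = {\<one>\<^bsub>G\<^esub>}"
  have *: "e = \<one>\<^bsub>L\<^esub>" if "e \<in> carrier L" "f \<in> carrier L" "e \<otimes>\<^bsub>L\<^esub> f = \<one>\<^bsub>L\<^esub>" for e f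
    using that idem[of e] L.m_assoc[of e e f] by simp
  have **: "f = \<one>\<^bsub>L\<^esub>" if "e \<in> carrier L" "f \<in> carrier L" "e \<otimes>\<^bsub>L\<^esub> f = \<one>\<^bsub>L\<^esub>" for e f
    using that *[of f e] L.m_comm[of e f] by simp
  show "conical_monoid S"
    unfolding conical_monoid_def
  proof (intro conjI ballI impI comm_monoid_S)
    fix x y assume xy: "x \<in> carrier S" "y \<in> carrier S" "x \<otimes>\<^bsub>S\<^esub> y = \<one>\<^bsub>S\<^esub>"
    obtain e a f b where eq: "x = (e, a)" "y = (f, b)" by (cases x, cases y)
    have ef: "e \<in> carrier L" "f \<in> carrier L" "e \<otimes>\<^bsub>L\<^esub> f = \<one>\<^bsub>L\<^esub>" and ab: "a \<in> H e" "b \<in> H f"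
      using xy by (auto simp: eq)
    show "x = \<one>\<^bsub>S\<^esub>" "y = \<one>\<^bsub>S\<^esub>"
      using *[OF ef] **[OF ef] ab H1 by (auto simp: eq)
  qed
qed

text \<open>The purity condition on \<open>S\<close> compares \<open>H e\<close> only with the
  groups \<open>H f\<close> above it. These suffice, because every element of \<open>G\<close> lies
  in some such \<open>H f\<close>.\<close>

lemma purity_S: "purity_condition S \<longleftrightarrow> (\<forall>e\<in>carrier L. pure_subgroup (H e) G)"
proof -
  have "purity_condition S \<longleftrightarrow> (\<forall>e\<in>carrier L. \<forall>f\<in>carrier L. alg_le L e f \<longrightarrow>
     (\<forall>n>0. \<forall>x\<in>H f. \<forall>y\<in>H e. x [^]\<^bsub>G\<^esub> (n::nat) = y \<longrightarrow> (\<exists>z\<in>H e. y = z [^]\<^bsub>G\<^esub> n)))"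
    (is "_ \<longleftrightarrow> (\<forall>e\<in>_. \<forall>f\<in>_. _ \<longrightarrow> ?Q e f)")
    unfolding S.purity_condition_iff idempotents_S ball_simps
  proof (intro ball_cong refl imp_cong)
    fix e f assume e: "e \<in> carrier L" and f: "f \<in> carrier L"
    show "alg_le S (e, \<one>\<^bsub>G\<^esub>) (f, \<one>\<^bsub>G\<^esub>) = alg_le L e f"
      using e f by (simp add: S_alg_le H_one)
    assume "alg_le L e f"
    then have [simp]: "e \<otimes>\<^bsub>L\<^esub> f = f" using e f le_iff by simp
    show "(\<forall>n>0. \<forall>x\<in>carrier (idem_group S (f, \<one>\<^bsub>G\<^esub>)). \<forall>y\<in>carrier (idem_group S (e, \<one>\<^bsub>G\<^esub>)).
        x [^]\<^bsub>S\<^esub> (n::nat) = y \<otimes>\<^bsub>S\<^esub> (f, \<one>\<^bsub>G\<^esub>) \<longrightarrow>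
        (\<exists>z\<in>carrier (idem_group S (e, \<one>\<^bsub>G\<^esub>)). y \<otimes>\<^bsub>S\<^esub> (f, \<one>\<^bsub>G\<^esub>) = z [^]\<^bsub>S\<^esub> n \<otimes>\<^bsub>S\<^esub> (f, \<one>\<^bsub>G\<^esub>))) \<longleftrightarrow>
      ?Q e f"
      unfolding idem_group_S[OF e] idem_group_S[OF f]
      by (intro all_cong) (simp add: e f S_pow H_carrier[OF e] H_carrier[OF f] cong: ball_cong bex_cong conj_cong)
  qed
  also have "\<dots> \<longleftrightarrow> (\<forall>e\<in>carrier L. \<forall>n>0. \<forall>x\<in>carrier G. \<forall>y\<in>H e. x [^]\<^bsub>G\<^esub> (n::nat) = y \<longrightarrow>
      (\<exists>z\<in>H e. y = z [^]\<^bsub>G\<^esub> n))" (is "?A \<longleftrightarrow> ?B")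
  proof
    assume A: ?A
    show ?B
    proof (intro ballI allI impI)
      fix e x y and n :: nat
      assume *: "e \<in> carrier L" "n > 0" "x \<in> carrier G" "y \<in> H e" "x [^]\<^bsub>G\<^esub> n = y"
      \<comment> \<open>The index f containing x may be incomparable with e; enlarging it to e + f
        puts it above e and keeps x.\<close>
      obtain f where f: "f \<in> carrier L" "x \<in> H f" using * carrier_G by blast
      then have "e \<otimes>\<^bsub>L\<^esub> f \<in> carrier L" "x \<in> H (e \<otimes>\<^bsub>L\<^esub> f)" "alg_le L e (e \<otimes>\<^bsub>L\<^esub> f)"
        using * H_mono(2)[of e f] by (auto intro: L.alg_le_mult_left)
      then show "\<exists>z\<in>H e. y = z [^]\<^bsub>G\<^esub> n" using A * by blast
    qed
  next
    assume ?B
    then show ?A using H_carrier by blast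
  qed
  also have "\<dots> \<longleftrightarrow> (\<forall>e\<in>carrier L. pure_subgroup (H e) G)"
  proof (intro ball_cong refl)
    fix e assume e: "e \<in> carrier L"
    have "(\<lambda>x. x [^]\<^bsub>G\<^esub> (n::nat)) ` H e \<subseteq> (\<lambda>x. x [^]\<^bsub>G\<^esub> n) ` carrier G \<inter> H e" for n
      using H_pow[OF e] H_carrier[OF e] by blast
    then have "pure_subgroup (H e) G \<longleftrightarrow> (\<forall>n::nat. n > 0 \<longrightarrow>
        (\<lambda>x. x [^]\<^bsub>G\<^esub> n) ` carrier G \<inter> H e \<subseteq> (\<lambda>x. x [^]\<^bsub>G\<^esub> n) ` H e)"
      unfolding pure_subgroup_def using subgroup_H[OF e] by (simp add: set_eq_subset)
    then show "(\<forall>n>0. \<forall>x\<in>carrier G. \<forall>y\<in>H e. x [^]\<^bsub>G\<^esub> (n::nat) = y \<longrightarrow> (\<exists>z\<in>H e. y = z [^]\<^bsub>G\<^esub> n)) \<longleftrightarrow>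
        pure_subgroup (H e) G"
      by (simp add: subset_iff image_iff) blast
  qed
  finally show ?thesis .
qed

end

section \<open>Refinement in the fibred monoid\<close>

lemma refinementE:
  assumes "refinement_monoid M" "x1 \<in> carrier M" "x2 \<in> carrier M" "y1 \<in> carrier M" "y2 \<in> carrier M"
    and "x1 \<otimes>\<^bsub>M\<^esub> x2 = y1 \<otimes>\<^bsub>M\<^esub> y2"
  obtains z11 z12 z21 z22 where
    "z11 \<in> carrier M" "z12 \<in> carrier M" "z21 \<in> carrier M" "z22 \<in> carrier M"
    "x1 = z11 \<otimes>\<^bsub>M\<^esub> z12" "x2 = z21 \<otimes>\<^bsub>M\<^esub> z22" "y1 = z11 \<otimes>\<^bsub>M\<^esub> z21" "y2 = z12 \<otimes>\<^bsub>M\<^esub> z22"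
proof -
  have "\<exists>z11\<in>carrier M. \<exists>z12\<in>carrier M. \<exists>z21\<in>carrier M. \<exists>z22\<in>carrier M.
      x1 = z11 \<otimes>\<^bsub>M\<^esub> z12 \<and> x2 = z21 \<otimes>\<^bsub>M\<^esub> z22 \<and> y1 = z11 \<otimes>\<^bsub>M\<^esub> z21 \<and> y2 = z12 \<otimes>\<^bsub>M\<^esub> z22"
    using assms(1)[unfolded refinement_monoid_def, THEN conjunct2, rule_format, OF assms(2-6)] .
  then show thesis by (elim bexE conjE) (rule that)
qed

context semilattice_of_subgroups
begin

lemma refinement_S_E:
  assumes ref: "refinement_monoid S"
    and c: "e1 \<in> carrier L" "e2 \<in> carrier L" "f1 \<in> carrier L" "f2 \<in> carrier L"
      "a1 \<in> H e1" "a2 \<in> H e2" "b1 \<in> H f1" "b2 \<in> H f2"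
    and eq: "e1 \<otimes>\<^bsub>L\<^esub> e2 = f1 \<otimes>\<^bsub>L\<^esub> f2" "a1 \<otimes>\<^bsub>G\<^esub> a2 = b1 \<otimes>\<^bsub>G\<^esub> b2"
  obtains g11 g12 g21 g22 c11 c12 c21 c22 where
    "g11 \<in> carrier L" "g12 \<in> carrier L" "g21 \<in> carrier L" "g22 \<in> carrier L"
    "c11 \<in> H g11" "c12 \<in> H g12" "c21 \<in> H g21" "c22 \<in> H g22"
    "e1 = g11 \<otimes>\<^bsub>L\<^esub> g12" "e2 = g21 \<otimes>\<^bsub>L\<^esub> g22" "f1 = g11 \<otimes>\<^bsub>L\<^esub> g21" "f2 = g12 \<otimes>\<^bsub>L\<^esub> g22"
    "a1 = c11 \<otimes>\<^bsub>G\<^esub> c12" "a2 = c21 \<otimes>\<^bsub>G\<^esub> c22" "b1 = c11 \<otimes>\<^bsub>G\<^esub> c21" "b2 = c12 \<otimes>\<^bsub>G\<^esub> c22"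
proof -
  have "(e1, a1) \<in> carrier S" "(e2, a2) \<in> carrier S" "(f1, b1) \<in> carrier S" "(f2, b2) \<in> carrier S"
    "(e1, a1) \<otimes>\<^bsub>S\<^esub> (e2, a2) = (f1, b1) \<otimes>\<^bsub>S\<^esub> (f2, b2)"
    using c eq by auto
  from refinementE[OF ref this] obtain z11 z12 z21 z22 where
    z: "z11 \<in> carrier S" "z12 \<in> carrier S" "z21 \<in> carrier S" "z22 \<in> carrier S"
    "(e1, a1) = z11 \<otimes>\<^bsub>S\<^esub> z12" "(e2, a2) = z21 \<otimes>\<^bsub>S\<^esub> z22"
    "(f1, b1) = z11 \<otimes>\<^bsub>S\<^esub> z21" "(f2, b2) = z12 \<otimes>\<^bsub>S\<^esub> z22" .
  obtain g11 c11 g12 c12 g21 c21 g22 c22 where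
    "z11 = (g11, c11)" "z12 = (g12, c12)" "z21 = (g21, c21)" "z22 = (g22, c22)"
    by (cases z11, cases z12, cases z21, cases z22)
  with z that[of g11 g12 g21 g22 c11 c12 c21 c22] show thesis by simp
qed

lemma semilattice_L: "semilattice_monoid L"
  unfolding semilattice_monoid_def using idem L.comm_monoid_axioms by blast

text \<open>Give every element of the semilattice the group coordinate zero and project the
  refinement back.\<close>

lemma refinement_S_imp_distributive:
  assumes "refinement_monoid S"
  shows "distributive_semilattice L"
  unfolding distributive_semilattice_def refinement_monoid_def
proof (intro conjI ballI impI semilattice_L L.comm_monoid_axioms)
  fix e1 e2 f1 f2
  assume e: "e1 \<in> carrier L" "e2 \<in> carrier L" "f1 \<in> carrier L" "f2 \<in> carrier L"
    and eq: "e1 \<otimes>\<^bsub>L\<^esub> e2 = f1 \<otimes>\<^bsub>L\<^esub> f2"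
  obtain g11 g12 g21 g22 where
    "g11 \<in> carrier L" "g12 \<in> carrier L" "g21 \<in> carrier L" "g22 \<in> carrier L"
    "e1 = g11 \<otimes>\<^bsub>L\<^esub> g12" "e2 = g21 \<otimes>\<^bsub>L\<^esub> g22" "f1 = g11 \<otimes>\<^bsub>L\<^esub> g21" "f2 = g12 \<otimes>\<^bsub>L\<^esub> g22"
    by (rule refinement_S_E[OF assms e H_one[OF e(1)] H_one[OF e(2)] H_one[OF e(3)] H_one[OF e(4)] eq refl])
  then show "\<exists>z11\<in>carrier L. \<exists>z12\<in>carrier L. \<exists>z21\<in>carrier L. \<exists>z22\<in>carrier L.
       e1 = z11 \<otimes>\<^bsub>L\<^esub> z12 \<and> e2 = z21 \<otimes>\<^bsub>L\<^esub> z22 \<and> f1 = z11 \<otimes>\<^bsub>L\<^esub> z21 \<and> f2 = z12 \<otimes>\<^bsub>L\<^esub> z22"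
    by blast
qed

text \<open>For a in the group at d = e + f, refine (d, a) + (d, -a) = (e, 0) + (f, 0). The first
  row writes a as a sum of two entries, whose indices lie below e and f because of the
  columns.\<close>

lemma refinement_S_imp_set_mult:
  assumes ref: "refinement_monoid S" and ef: "e \<in> carrier L" "f \<in> carrier L"
  shows "H e <#>\<^bsub>G\<^esub> H f = H (e \<otimes>\<^bsub>L\<^esub> f)"
proof
  show "H e <#>\<^bsub>G\<^esub> H f \<subseteq> H (e \<otimes>\<^bsub>L\<^esub> f)"
    using ef by (auto simp: set_mult_def H_mult')
next
  show "H (e \<otimes>\<^bsub>L\<^esub> f) \<subseteq> H e <#>\<^bsub>G\<^esub> H f"
  proof
    fix a assume a: "a \<in> H (e \<otimes>\<^bsub>L\<^esub> f)"
    let ?d = "e \<otimes>\<^bsub>L\<^esub> f"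
    have d: "?d \<in> carrier L" using ef by simp
    have eq: "?d \<otimes>\<^bsub>L\<^esub> ?d = e \<otimes>\<^bsub>L\<^esub> f" "a \<otimes>\<^bsub>G\<^esub> inv\<^bsub>G\<^esub> a = \<one>\<^bsub>G\<^esub> \<otimes>\<^bsub>G\<^esub> \<one>\<^bsub>G\<^esub>"
      using idem[OF d] H_carrier[OF d a] by auto
    obtain g11 g12 g21 g22 c11 c12 where
      g: "g11 \<in> carrier L" "g12 \<in> carrier L" "g21 \<in> carrier L" "g22 \<in> carrier L" and
      c: "c11 \<in> H g11" "c12 \<in> H g12" and
      ge: "e = g11 \<otimes>\<^bsub>L\<^esub> g21" "f = g12 \<otimes>\<^bsub>L\<^esub> g22" and ca: "a = c11 \<otimes>\<^bsub>G\<^esub> c12"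
      by (rule refinement_S_E[OF ref d d ef a H_inv[OF d a] H_one[OF ef(1)] H_one[OF ef(2)] eq])
    have "c11 \<in> H e" "c12 \<in> H f"
      using c H_mono(1)[OF g(1,3)] H_mono(1)[OF g(2,4)] by (auto simp: ge)
    then show "a \<in> H e <#>\<^bsub>G\<^esub> H f" using ca by (auto simp: set_mult_def)
  qed
qed

text \<open>For a in both groups, refine (e, a) + (f, 0) = (f, a) + (e, 0), with the indices crossed
  on the right. Each diagonal index then lies below both e and f, through its row and its
  column.\<close>

lemma refinement_S_imp_Int:
  assumes ref: "refinement_monoid S" and ef: "e \<in> carrier L" "f \<in> carrier L"
  shows "H e \<inter> H f = (\<Union>g\<in>{g \<in> carrier L. alg_le L g e \<and> alg_le L g f}. H g)"
proof
  show "(\<Union>g\<in>{g \<in> carrier L. alg_le L g e \<and> alg_le L g f}. H g) \<subseteq> H e \<inter> H f"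
    using mono_H by blast
  show "H e \<inter> H f \<subseteq> (\<Union>g\<in>{g \<in> carrier L. alg_le L g e \<and> alg_le L g f}. H g)"
  proof
    fix a assume "a \<in> H e \<inter> H f"
    then have a: "a \<in> H e" "a \<in> H f" by auto
    have eq: "e \<otimes>\<^bsub>L\<^esub> f = f \<otimes>\<^bsub>L\<^esub> e" "a \<otimes>\<^bsub>G\<^esub> \<one>\<^bsub>G\<^esub> = a \<otimes>\<^bsub>G\<^esub> \<one>\<^bsub>G\<^esub>"
      using ef by (auto simp: L.m_comm)
    obtain g11 g12 g21 g22 c11 c12 c21 c22 where
      g: "g11 \<in> carrier L" "g12 \<in> carrier L" "g21 \<in> carrier L" "g22 \<in> carrier L" and
      c: "c11 \<in> H g11" "c12 \<in> H g12" "c22 \<in> H g22" and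
      ge: "e = g11 \<otimes>\<^bsub>L\<^esub> g12" "f = g21 \<otimes>\<^bsub>L\<^esub> g22" "f = g11 \<otimes>\<^bsub>L\<^esub> g21" "e = g12 \<otimes>\<^bsub>L\<^esub> g22" and
      ca: "a = c11 \<otimes>\<^bsub>G\<^esub> c12" "\<one>\<^bsub>G\<^esub> = c12 \<otimes>\<^bsub>G\<^esub> c22"
      by (rule refinement_S_E[OF ref ef ef(2,1) a(1) H_one[OF ef(2)] a(2) H_one[OF ef(1)] eq])
    \<comment> \<open>The second column sums to zero, so the off-diagonal entry \<open>c12\<close>
      also lies in the group at the diagonal index \<open>g22\<close>. Hence a lies in the group at
      \<open>g11\<close> + \<open>g22\<close>, which is below e and f.\<close>
    have "inv\<^bsub>G\<^esub> c22 = c12"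
      using ca(2) c g H_carrier by (intro G.inv_equality) auto
    then have "c12 \<in> H g22" using H_inv g c by blast
    then have "a \<in> H (g11 \<otimes>\<^bsub>L\<^esub> g22)" using ca(1) c g by (simp add: H_mult')
    moreover have "alg_le L g11 e" "alg_le L g22 e"
      using g L.alg_le_mult_left[of g11 g12] L.alg_le_mult_right[of g12 g22] by (simp_all flip: ge(1,4))
    then have "(g11 \<otimes>\<^bsub>L\<^esub> g22) \<otimes>\<^bsub>L\<^esub> e = e"
      using g ef le_iff by (simp add: L.m_assoc)
    moreover have "alg_le L g11 f" "alg_le L g22 f"
      using g L.alg_le_mult_left[of g11 g21] L.alg_le_mult_right[of g21 g22] by (simp_all flip: ge(2,3))
    then have "(g11 \<otimes>\<^bsub>L\<^esub> g22) \<otimes>\<^bsub>L\<^esub> f = f"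
      using g ef le_iff by (simp add: L.m_assoc)
    ultimately show "a \<in> (\<Union>g\<in>{g \<in> carrier L. alg_le L g e \<and> alg_le L g f}. H g)"
      using g ef le_iff by auto
  qed
qed

text \<open>Since g is absorbed by x1 + x2, the equation g + (x1 + x2) = x1 + x2 can be refined; its
  first row splits g.\<close>

lemma le_mult_split:
  assumes "refinement_monoid L" "g \<in> carrier L" "x1 \<in> carrier L" "x2 \<in> carrier L"
    and "alg_le L g (x1 \<otimes>\<^bsub>L\<^esub> x2)"
  obtains g1 g2 where "g1 \<in> carrier L" "g2 \<in> carrier L" "g = g1 \<otimes>\<^bsub>L\<^esub> g2"
    "alg_le L g1 x1" "alg_le L g2 x2"
proof -
  have absorb: "g \<otimes>\<^bsub>L\<^esub> (x1 \<otimes>\<^bsub>L\<^esub> x2) = x1 \<otimes>\<^bsub>L\<^esub> x2" using assms le_iff by simp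
  obtain z11 z12 z21 z22 where
    "z11 \<in> carrier L" "z12 \<in> carrier L" "z21 \<in> carrier L" "z22 \<in> carrier L"
    "g = z11 \<otimes>\<^bsub>L\<^esub> z12" "x1 = z11 \<otimes>\<^bsub>L\<^esub> z21" "x2 = z12 \<otimes>\<^bsub>L\<^esub> z22"
    by (rule refinementE[OF assms(1,2) L.m_closed[OF assms(3,4)] assms(3,4) absorb])
  then show ?thesis
    using that[of z11 z12] L.alg_le_mult_left[of z11 z21] L.alg_le_mult_left[of z12 z22] by simp
qed

text \<open>A refinement of the semilattice coordinates is filled with group elements matching both row
  sums; the columns are then off by some \<open>d\<close> and its inverse. Since \<open>d\<close> lies in both column
  groups, it comes from some \<open>g\<close> below both columns, and splitting \<open>g\<close> and \<open>d\<close> along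
  the rows allows a correction that leaves the row sums unchanged.\<close>

lemma refinement_S:
  assumes dist: "distributive_semilattice L"
    and sum: "\<And>e f. e \<in> carrier L \<Longrightarrow> f \<in> carrier L \<Longrightarrow> H e <#>\<^bsub>G\<^esub> H f = H (e \<otimes>\<^bsub>L\<^esub> f)"
    and int: "\<And>e f. e \<in> carrier L \<Longrightarrow> f \<in> carrier L \<Longrightarrow>
      H e \<inter> H f = (\<Union>g\<in>{g \<in> carrier L. alg_le L g e \<and> alg_le L g f}. H g)"
  shows "refinement_monoid S"
  unfolding refinement_monoid_def
proof (intro conjI ballI impI comm_monoid_S)
  have ref: "refinement_monoid L" using dist by (simp add: distributive_semilattice_def)
  have split: "\<exists>b\<in>H e. \<exists>c\<in>H f. a = b \<otimes>\<^bsub>G\<^esub> c"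
    if "e \<in> carrier L" "f \<in> carrier L" "a \<in> H (e \<otimes>\<^bsub>L\<^esub> f)" for a e f
    using that(3) unfolding sum[OF that(1,2), symmetric] by (auto simp: set_mult_def)
  fix p1 p2 q1 q2
  assume pq: "p1 \<in> carrier S" "p2 \<in> carrier S" "q1 \<in> carrier S" "q2 \<in> carrier S"
    and pq_eq: "p1 \<otimes>\<^bsub>S\<^esub> p2 = q1 \<otimes>\<^bsub>S\<^esub> q2"
  obtain x1 a1 x2 a2 y1 b1 y2 b2 where
    pairs: "p1 = (x1, a1)" "p2 = (x2, a2)" "q1 = (y1, b1)" "q2 = (y2, b2)"
    by (cases p1, cases p2, cases q1, cases q2)
  have c: "x1 \<in> carrier L" "x2 \<in> carrier L" "y1 \<in> carrier L" "y2 \<in> carrier L"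
    and a: "a1 \<in> H x1" "a2 \<in> H x2" "b1 \<in> H y1" "b2 \<in> H y2"
    and xy: "x1 \<otimes>\<^bsub>L\<^esub> x2 = y1 \<otimes>\<^bsub>L\<^esub> y2" and ab: "a1 \<otimes>\<^bsub>G\<^esub> a2 = b1 \<otimes>\<^bsub>G\<^esub> b2"
    using pq pq_eq unfolding pairs by auto
  obtain e11 e12 e21 e22 where
    e: "e11 \<in> carrier L" "e12 \<in> carrier L" "e21 \<in> carrier L" "e22 \<in> carrier L" and
    xe: "x1 = e11 \<otimes>\<^bsub>L\<^esub> e12" "x2 = e21 \<otimes>\<^bsub>L\<^esub> e22" "y1 = e11 \<otimes>\<^bsub>L\<^esub> e21" "y2 = e12 \<otimes>\<^bsub>L\<^esub> e22"
    by (rule refinementE[OF ref c xy])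
  obtain c11 c12 where c1: "c11 \<in> H e11" "c12 \<in> H e12" "a1 = c11 \<otimes>\<^bsub>G\<^esub> c12"
    using split e a(1) xe(1) by blast
  obtain c21 c22 where c2: "c21 \<in> H e21" "c22 \<in> H e22" "a2 = c21 \<otimes>\<^bsub>G\<^esub> c22"
    using split e a(2) xe(2) by blast
  have Gc: "c11 \<in> carrier G" "c12 \<in> carrier G" "c21 \<in> carrier G" "c22 \<in> carrier G"
    "b1 \<in> carrier G" "b2 \<in> carrier G"
    using H_carrier e c a c1 c2 by auto
  define d where "d = b1 \<otimes>\<^bsub>G\<^esub> inv\<^bsub>G\<^esub> (c11 \<otimes>\<^bsub>G\<^esub> c21)"
  have b1: "b1 = (c11 \<otimes>\<^bsub>G\<^esub> c21) \<otimes>\<^bsub>G\<^esub> d"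
    using Gc by (simp add: d_def G.m_lcomm)
  have dG: "d \<in> carrier G" using Gc by (simp add: d_def)
  have "(c11 \<otimes>\<^bsub>G\<^esub> c21) \<otimes>\<^bsub>G\<^esub> (c12 \<otimes>\<^bsub>G\<^esub> c22) = a1 \<otimes>\<^bsub>G\<^esub> a2"
    using c1(3) c2(3) Gc G.mult_mult_swap by simp
  also have "\<dots> = (c11 \<otimes>\<^bsub>G\<^esub> c21) \<otimes>\<^bsub>G\<^esub> (d \<otimes>\<^bsub>G\<^esub> b2)"
    unfolding ab b1 using Gc dG by (simp add: G.m_assoc)
  finally have db2: "c12 \<otimes>\<^bsub>G\<^esub> c22 = d \<otimes>\<^bsub>G\<^esub> b2" using Gc dG by simp
  have b2: "b2 = (c12 \<otimes>\<^bsub>G\<^esub> c22) \<otimes>\<^bsub>G\<^esub> inv\<^bsub>G\<^esub> d"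
    unfolding db2 using Gc dG by (simp add: G.m_ac)
  \<comment> \<open>The definition of \<open>d\<close> measures the error in the first column;
    expressing it through the second column shows that it lies in \<open>H y2\<close> as
    well.\<close>
  have d2: "d = (c12 \<otimes>\<^bsub>G\<^esub> c22) \<otimes>\<^bsub>G\<^esub> inv\<^bsub>G\<^esub> b2"
    unfolding db2 using Gc dG by (simp add: G.m_assoc)
  have "d \<in> H y1"
    unfolding d_def using H_mult'[OF e(1,3) c1(1) c2(1)] c(3) a(3) H_mult H_inv by (simp flip: xe(3))
  moreover have "d \<in> H y2"
    unfolding d2 using H_mult'[OF e(2,4) c1(2) c2(2)] c(4) a(4) H_mult H_inv by (simp flip: xe(4))
  ultimately obtain g where g: "g \<in> carrier L" "alg_le L g y1" "alg_le L g y2" "d \<in> H g"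
    using int[OF c(3,4)] by blast
  have "alg_le L g (x1 \<otimes>\<^bsub>L\<^esub> x2)"
    unfolding xy using g(2) L.alg_le_mult_left[OF c(3,4)] by (rule L.alg_le_trans)
  then obtain g1 g2 where gs: "g1 \<in> carrier L" "g2 \<in> carrier L" "g = g1 \<otimes>\<^bsub>L\<^esub> g2"
    "alg_le L g1 x1" "alg_le L g2 x2"
    by (rule le_mult_split[OF ref g(1) c(1,2)])
  obtain u v where uv: "u \<in> H g1" "v \<in> H g2" "d = u \<otimes>\<^bsub>G\<^esub> v"
    using split gs g(4) by blast
  have Guv: "u \<in> carrier G" "v \<in> carrier G" using uv gs H_carrier by auto
  \<comment> \<open>The indices must grow to accommodate the corrections: \<open>g1\<close> is added
    along the first row and \<open>g2\<close> along the second. The row sums absorb them because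
    \<open>g1\<close> is below \<open>x1\<close> and \<open>g2\<close> below \<open>x2\<close>; each
    column receives \<open>g1\<close> + \<open>g2\<close> = \<open>g\<close>, which is below
    \<open>y1\<close> and \<open>y2\<close>.\<close>
  let ?z11 = "(e11 \<otimes>\<^bsub>L\<^esub> g1, c11 \<otimes>\<^bsub>G\<^esub> u)" and ?z12 = "(e12 \<otimes>\<^bsub>L\<^esub> g1, c12 \<otimes>\<^bsub>G\<^esub> inv\<^bsub>G\<^esub> u)"
  let ?z21 = "(e21 \<otimes>\<^bsub>L\<^esub> g2, c21 \<otimes>\<^bsub>G\<^esub> v)" and ?z22 = "(e22 \<otimes>\<^bsub>L\<^esub> g2, c22 \<otimes>\<^bsub>G\<^esub> inv\<^bsub>G\<^esub> v)"
  have z: "?z11 \<in> carrier S" "?z12 \<in> carrier S" "?z21 \<in> carrier S" "?z22 \<in> carrier S"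
    using e gs c1 c2 uv by (auto intro!: H_mult' H_inv)
  have absorb: "x \<otimes>\<^bsub>L\<^esub> h = x" if "alg_le L h x" for h x
    using that le_iff L.alg_le_closed[OF that] L.m_comm by metis
  have "p1 = ?z11 \<otimes>\<^bsub>S\<^esub> ?z12"
    using e gs Gc Guv c1(3) L.mult_mult_swap[of e11 g1 e12 g1] G.mult_mult_swap[of c11 u c12 "inv\<^bsub>G\<^esub> u"]
      absorb[OF gs(4)] by (simp add: pairs xe(1) idem)
  moreover have "p2 = ?z21 \<otimes>\<^bsub>S\<^esub> ?z22"
    using e gs Gc Guv c2(3) L.mult_mult_swap[of e21 g2 e22 g2] G.mult_mult_swap[of c21 v c22 "inv\<^bsub>G\<^esub> v"]
      absorb[OF gs(5)] by (simp add: pairs xe(2) idem)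
  moreover have "q1 = ?z11 \<otimes>\<^bsub>S\<^esub> ?z21"
    using e gs Gc Guv L.mult_mult_swap[of e11 g1 e21 g2] G.mult_mult_swap[of c11 u c21 v]
      absorb[OF g(2)] b1 uv(3) by (simp add: pairs xe(3))
  moreover have "q2 = ?z12 \<otimes>\<^bsub>S\<^esub> ?z22"
    using e gs Gc Guv L.mult_mult_swap[of e12 g1 e22 g2]
      G.mult_mult_swap[of c12 "inv\<^bsub>G\<^esub> u" c22 "inv\<^bsub>G\<^esub> v"]
      absorb[OF g(3)] b2 uv(3) by (simp add: pairs xe(4) G.inv_mult)
  ultimately show "\<exists>z11\<in>carrier S. \<exists>z12\<in>carrier S. \<exists>z21\<in>carrier S. \<exists>z22\<in>carrier S.
      p1 = z11 \<otimes>\<^bsub>S\<^esub> z12 \<and> p2 = z21 \<otimes>\<^bsub>S\<^esub> z22 \<and> q1 = z11 \<otimes>\<^bsub>S\<^esub> z21 \<and> q2 = z12 \<otimes>\<^bsub>S\<^esub> z22"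
    using z by (intro bexI conjI)
qed

end

section \<open>The maximal group image of a regular monoid\<close>

definition cancel_class :: "('a, 'b) monoid_scheme \<Rightarrow> 'a \<Rightarrow> 'a set" where
  "cancel_class M x = {y \<in> carrier M. \<exists>f\<in>idempotents M. x \<otimes>\<^bsub>M\<^esub> f = y \<otimes>\<^bsub>M\<^esub> f}"

text \<open>The union over representatives avoids choosing any; by \<open>cancel_class_mult\<close>
  all the classes in it coincide.\<close>

definition max_group_image :: "('a, 'b) monoid_scheme \<Rightarrow> 'a set monoid" where
  "max_group_image M = \<lparr>carrier = cancel_class M ` carrier M,
     monoid.mult = (\<lambda>A B. \<Union>a\<in>A. \<Union>b\<in>B. cancel_class M (a \<otimes>\<^bsub>M\<^esub> b)), one = cancel_class M \<one>\<^bsub>M\<^esub>\<rparr>"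

text \<open>A fresh record instead of an update of \<open>M\<close>, so that the result has the
  plain type \<open>monoid\<close> required of the semilattice in the theorem.\<close>

definition idem_semilattice :: "('a, 'b) monoid_scheme \<Rightarrow> 'a monoid" where
  "idem_semilattice M = \<lparr>carrier = idempotents M, monoid.mult = monoid.mult M, one = \<one>\<^bsub>M\<^esub>\<rparr>"

lemma idem_semilattice_simps [simp]:
  "carrier (idem_semilattice M) = idempotents M"
  "e \<otimes>\<^bsub>idem_semilattice M\<^esub> f = e \<otimes>\<^bsub>M\<^esub> f"
  "\<one>\<^bsub>idem_semilattice M\<^esub> = \<one>\<^bsub>M\<^esub>"
  by (auto simp: idem_semilattice_def)

context comm_monoid
begin

lemma idempotents_carrier: "e \<in> idempotents G \<Longrightarrow> e \<in> carrier G"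
  and idempotents_idem: "e \<in> idempotents G \<Longrightarrow> e \<otimes> e = e"
  by (auto simp: idempotents_def)

lemma one_idempotents: "\<one> \<in> idempotents G"
  by (simp add: idempotents_def)

lemma comm_monoid_idem_semilattice: "comm_monoid (idem_semilattice G)"
  by (rule comm_monoidI)
    (auto simp: idempotents_mult idempotents_carrier one_idempotents m_ac)

section \<open>The congruence that cancels idempotents\<close>

lemma mem_cancel_class_iff:
  "y \<in> cancel_class G x \<longleftrightarrow> y \<in> carrier G \<and> (\<exists>f\<in>idempotents G. x \<otimes> f = y \<otimes> f)"
  by (auto simp: cancel_class_def)

lemma cancel_class_refl: "x \<in> carrier G \<Longrightarrow> x \<in> cancel_class G x"
  using one_idempotents by (auto simp: mem_cancel_class_iff)

lemma cancel_trans: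
  assumes "x \<in> carrier G" "y \<in> carrier G" "z \<in> carrier G" "f \<in> idempotents G" "g \<in> idempotents G"
    and "x \<otimes> f = y \<otimes> f" "y \<otimes> g = z \<otimes> g"
  shows "x \<otimes> (f \<otimes> g) = z \<otimes> (f \<otimes> g)"
proof -
  have fg: "f \<in> carrier G" "g \<in> carrier G" using assms idempotents_carrier by auto
  have "x \<otimes> (f \<otimes> g) = (y \<otimes> f) \<otimes> g" using assms fg by (simp flip: m_assoc)
  also have "\<dots> = (y \<otimes> g) \<otimes> f" using assms(2) fg by (simp add: m_ac)
  also have "\<dots> = z \<otimes> (f \<otimes> g)" unfolding assms(7) using assms(3) fg by (simp add: m_ac)
  finally show ?thesis .
qed

lemma cancel_class_eq_iff:
  assumes "x \<in> carrier G" "y \<in> carrier G"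
  shows "cancel_class G x = cancel_class G y \<longleftrightarrow> (\<exists>f\<in>idempotents G. x \<otimes> f = y \<otimes> f)"
proof
  assume "cancel_class G x = cancel_class G y"
  then have "y \<in> cancel_class G x" using cancel_class_refl[OF assms(2)] by simp
  then show "\<exists>f\<in>idempotents G. x \<otimes> f = y \<otimes> f" by (simp add: mem_cancel_class_iff)
next
  have *: "cancel_class G v \<subseteq> cancel_class G u"
    if "u \<in> carrier G" "v \<in> carrier G" "f \<in> idempotents G" "u \<otimes> f = v \<otimes> f" for u v f
  proof
    fix w assume "w \<in> cancel_class G v"
    then obtain g where "w \<in> carrier G" "g \<in> idempotents G" "v \<otimes> g = w \<otimes> g"
      by (auto simp: mem_cancel_class_iff)
    then show "w \<in> cancel_class G u"
      using cancel_trans[of u v w f g] idempotents_mult[of f g] that by (auto simp: mem_cancel_class_iff)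
  qed
  assume "\<exists>f\<in>idempotents G. x \<otimes> f = y \<otimes> f"
  then obtain f where f: "f \<in> idempotents G" "x \<otimes> f = y \<otimes> f" by blast
  show "cancel_class G x = cancel_class G y"
    using *[OF assms f] *[OF assms(2,1) f(1) f(2)[symmetric]] by blast
qed

text \<open>If f identifies a with x and g identifies b with y, the idempotent f + g identifies a +
  b with x + y.\<close>

lemma cancel_class_mult:
  assumes x: "x \<in> carrier G" and y: "y \<in> carrier G"
  shows "cancel_class G x \<otimes>\<^bsub>max_group_image G\<^esub> cancel_class G y = cancel_class G (x \<otimes> y)"
proof -
  have *: "cancel_class G (a \<otimes> b) = cancel_class G (x \<otimes> y)"
    if "a \<in> cancel_class G x" "b \<in> cancel_class G y" for a b
  proof -
    obtain f g where fg: "f \<in> idempotents G" "g \<in> idempotents G" "x \<otimes> f = a \<otimes> f" "y \<otimes> g = b \<otimes> g"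
      and ab: "a \<in> carrier G" "b \<in> carrier G"
      using \<open>a \<in> cancel_class G x\<close> \<open>b \<in> cancel_class G y\<close> unfolding mem_cancel_class_iff by blast
    have "(a \<otimes> b) \<otimes> (f \<otimes> g) = (x \<otimes> y) \<otimes> (f \<otimes> g)"
      using fg ab x y mult_mult_swap[of a b f g] mult_mult_swap[of x y f g] idempotents_carrier by simp
    then show ?thesis
      using cancel_class_eq_iff[of "a \<otimes> b" "x \<otimes> y"] ab x y idempotents_mult[OF fg(1,2)] by blast
  qed
  have "cancel_class G x \<otimes>\<^bsub>max_group_image G\<^esub> cancel_class G y =
      (\<Union>a\<in>cancel_class G x. \<Union>b\<in>cancel_class G y. cancel_class G (a \<otimes> b))"
    by (simp add: max_group_image_def)
  also have "\<dots> = (\<Union>a\<in>cancel_class G x. \<Union>b\<in>cancel_class G y. cancel_class G (x \<otimes> y))"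
    by (intro SUP_cong refl *)
  also have "\<dots> = cancel_class G (x \<otimes> y)"
    using cancel_class_refl[OF x] cancel_class_refl[OF y] by blast
  finally show ?thesis .
qed

lemma max_group_image_simps:
  "carrier (max_group_image G) = cancel_class G ` carrier G"
  "\<one>\<^bsub>max_group_image G\<^esub> = cancel_class G \<one>"
  by (auto simp: max_group_image_def)

text \<open>The idempotent e itself identifies e with zero, as e + e = 0 + e.\<close>

lemma cancel_class_idem: "e \<in> idempotents G \<Longrightarrow> cancel_class G e = cancel_class G \<one>"
  using cancel_class_eq_iff[of e \<one>] by (auto simp: idempotents_def)

text \<open>Regularity gives z with 2x + z = x; then e = x + z absorbs x and is idempotent, with z
  as the complement of x.\<close>

lemma regular_idem_group:
  assumes "regular_monoid G" "x \<in> carrier G"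
  obtains e where "e \<in> idempotents G" "x \<in> carrier (idem_group G e)"
proof -
  obtain z where z: "z \<in> carrier G" "(x \<otimes> x) \<otimes> z = x"
    using assms by (auto simp: regular_monoid_def alg_le_def)
  have x: "(x \<otimes> z) \<otimes> x = x" using z assms(2) by (simp add: m_ac)
  have "(x \<otimes> z) \<otimes> (x \<otimes> z) = ((x \<otimes> z) \<otimes> x) \<otimes> z" using z(1) assms(2) by (simp add: m_assoc)
  then have "x \<otimes> z \<in> idempotents G" using z(1) assms(2) by (simp add: x idempotents_def)
  then show ?thesis
    using that[of "x \<otimes> z"] mem_idem_group_iff[of "x \<otimes> z" x] z(1) assms(2) x by auto
qed

text \<open>An idempotent absorbed by x is absorbed by every x + z, in particular by the other
  idempotent; by symmetry the two agree.\<close>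

lemma idem_group_unique:
  assumes "e \<in> idempotents G" "f \<in> idempotents G"
    and "x \<in> carrier (idem_group G e)" "x \<in> carrier (idem_group G f)"
  shows "e = f"
proof -
  have *: "u \<otimes> v = v" if "u \<in> idempotents G" "v \<in> idempotents G"
    "x \<in> carrier (idem_group G u)" "x \<in> carrier (idem_group G v)" for u v
  proof -
    note uv = that
    obtain z where "z \<in> carrier G" "x \<otimes> z = v" "u \<otimes> x = x" "x \<in> carrier G"
      using uv(3,4) unfolding mem_idem_group_iff[OF uv(1)] mem_idem_group_iff[OF uv(2)] by blast
    then show ?thesis using m_assoc[of u x z] idempotents_carrier[OF uv(1)] by simp
  qed
  show ?thesis
    using *[OF assms] *[OF assms(2,1,4,3)] m_comm[of e f] assms(1,2) idempotents_carrier by simp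
qed

text \<open>Inverses come from the decomposition into groups: x has a complement z with x + z
  idempotent, and idempotents have trivial class.\<close>

lemma comm_group_max_group_image:
  assumes reg: "regular_monoid G"
  shows "comm_group (max_group_image G)"
proof (rule comm_groupI, unfold max_group_image_simps)
  fix A assume "A \<in> cancel_class G ` carrier G"
  then obtain x where x: "x \<in> carrier G" "A = cancel_class G x" by blast
  obtain e where e: "e \<in> idempotents G" "x \<in> carrier (idem_group G e)"
    by (rule regular_idem_group[OF reg x(1)])
  then obtain z where "z \<in> carrier G" "x \<otimes> z = e"
    unfolding mem_idem_group_iff[OF e(1)] by blast
  then have "cancel_class G z \<otimes>\<^bsub>max_group_image G\<^esub> A = cancel_class G \<one>"
    using x cancel_class_mult[of z x] m_comm[of z x] cancel_class_idem[OF e(1)] by simp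
  then show "\<exists>B\<in>cancel_class G ` carrier G. B \<otimes>\<^bsub>max_group_image G\<^esub> A = cancel_class G \<one>"
    using \<open>z \<in> carrier G\<close> by blast
qed (auto simp: cancel_class_mult m_ac)

definition cancel_subgroup :: "'a \<Rightarrow> 'a set set" where
  "cancel_subgroup e = cancel_class G ` carrier (idem_group G e)"

lemma idem_group_carrier: "x \<in> carrier (idem_group G e) \<Longrightarrow> x \<in> carrier G"
  by (simp add: idem_group_def)

lemma semilattice_of_subgroups_idem:
  assumes reg: "regular_monoid G"
  shows "semilattice_of_subgroups (idem_semilattice G) (max_group_image G) cancel_subgroup"
proof -
  interpret L: comm_monoid "idem_semilattice G" by (rule comm_monoid_idem_semilattice)
  interpret Q: comm_group "max_group_image G" by (rule comm_group_max_group_image[OF reg])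
  show ?thesis
  proof (intro semilattice_of_subgroups.intro semilattice_of_subgroups_axioms.intro
      L.comm_monoid_axioms Q.comm_group_axioms)
    fix e assume "e \<in> carrier (idem_semilattice G)"
    then have e: "e \<in> idempotents G" by simp
    show "e \<otimes>\<^bsub>idem_semilattice G\<^esub> e = e" using idempotents_idem[OF e] by simp
    interpret E: comm_group "idem_group G e" by (rule comm_group_idem_group[OF e])
    have "cancel_class G \<in> hom (idem_group G e) (max_group_image G)"
      by (rule homI)
        (simp_all add: max_group_image_simps idem_group_carrier cancel_class_mult, simp add: idem_group_def)
    then interpret group_hom "idem_group G e" "max_group_image G" "cancel_class G"
      by unfold_locales
    show "subgroup (cancel_subgroup e) (max_group_image G)"
      unfolding cancel_subgroup_def by (rule img_is_subgroup)
  next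
    fix e f assume "alg_le (idem_semilattice G) e f"
    then have ef: "e \<in> idempotents G" "f \<in> idempotents G" "e \<otimes> f = f"
      using L.idem_alg_le_iff[of e f] L.alg_le_closed[of e f] idempotents_idem by auto
    show "cancel_subgroup e \<subseteq> cancel_subgroup f"
    proof
      fix A assume "A \<in> cancel_subgroup e"
      then obtain x where x: "x \<in> carrier (idem_group G e)" "A = cancel_class G x"
        by (auto simp: cancel_subgroup_def)
      have c: "x \<in> carrier G" "f \<in> carrier G"
        using x(1) ef(2) by (auto simp: idem_group_carrier idempotents_carrier)
      \<comment> \<open>Translation by f moves x into the larger group without changing its class, f
        itself being the identifying idempotent.\<close>
      have "x \<otimes> f = (x \<otimes> f) \<otimes> f" using c idempotents_idem[OF ef(2)] by (simp add: m_assoc)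
      then have "A = cancel_class G (x \<otimes> f)"
        using x(2) cancel_class_eq_iff[of x "x \<otimes> f"] c ef(2) by auto
      moreover have "x \<otimes> f \<in> carrier (idem_group G f)"
        using idem_group_mult[OF ef(1,2) x(1) idem_in_idem_group[OF ef(2)]] ef(3) by simp
      ultimately show "A \<in> cancel_subgroup f" by (auto simp: cancel_subgroup_def)
    qed
  next
    show "carrier (max_group_image G) = (\<Union>e\<in>carrier (idem_semilattice G). cancel_subgroup e)"
    proof
      show "carrier (max_group_image G) \<subseteq> (\<Union>e\<in>carrier (idem_semilattice G). cancel_subgroup e)"
      proof
        fix A assume "A \<in> carrier (max_group_image G)"
        then obtain x where x: "x \<in> carrier G" "A = cancel_class G x"
          by (auto simp: max_group_image_simps)
        obtain e where "e \<in> idempotents G" "x \<in> carrier (idem_group G e)"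
          by (rule regular_idem_group[OF reg x(1)])
        then show "A \<in> (\<Union>e\<in>carrier (idem_semilattice G). cancel_subgroup e)"
          using x(2) by (auto simp: cancel_subgroup_def)
      qed
    qed (auto simp: cancel_subgroup_def max_group_image_simps idem_group_carrier)
  qed
qed

section \<open>The isomorphism onto the fibred submonoid\<close>

definition idem_part :: "'a \<Rightarrow> 'a" where
  "idem_part x = (THE e. e \<in> idempotents G \<and> x \<in> carrier (idem_group G e))"

lemma idem_part_eq:
  assumes "e \<in> idempotents G" "x \<in> carrier (idem_group G e)"
  shows "idem_part x = e"
  unfolding idem_part_def
proof (rule the_equality)
  fix f assume "f \<in> idempotents G \<and> x \<in> carrier (idem_group G f)"
  then show "f = e" using idem_group_unique[of f e x] assms by simp
qed (use assms in simp)

lemma idem_part: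
  assumes "regular_monoid G" "x \<in> carrier G"
  shows "idem_part x \<in> idempotents G" "x \<in> carrier (idem_group G (idem_part x))"
proof -
  obtain e where "e \<in> idempotents G" "x \<in> carrier (idem_group G e)"
    by (rule regular_idem_group[OF assms])
  then show "idem_part x \<in> idempotents G" "x \<in> carrier (idem_group G (idem_part x))"
    using idem_part_eq[of e x] by auto
qed

lemma idem_part_mult:
  assumes "regular_monoid G" "x \<in> carrier G" "y \<in> carrier G"
  shows "idem_part (x \<otimes> y) = idem_part x \<otimes> idem_part y"
proof (rule idem_part_eq)
  note p = idem_part[OF assms(1,2)] idem_part[OF assms(1,3)]
  show "idem_part x \<otimes> idem_part y \<in> idempotents G" by (rule idempotents_mult[OF p(1,3)])
  show "x \<otimes> y \<in> carrier (idem_group G (idem_part x \<otimes> idem_part y))"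
    by (rule idem_group_mult[OF p(1,3,2,4)])
qed

lemma iso_fibred_submonoid:
  assumes reg: "regular_monoid G" and emb: "embedding_condition G"
  shows "(\<lambda>x. (idem_part x, cancel_class G x)) \<in>
    iso G (fibred_submonoid (idem_semilattice G) (max_group_image G) cancel_subgroup)"
    (is "?h \<in> iso G ?S")
proof -
  interpret semilattice_of_subgroups "idem_semilattice G" "max_group_image G" cancel_subgroup
    by (rule semilattice_of_subgroups_idem[OF reg])
  note p = idem_part[OF reg]
  have closed: "?h x \<in> carrier ?S" if "x \<in> carrier G" for x
    using p[OF that] by (auto simp: cancel_subgroup_def)
  have "?h \<in> hom G ?S"
    using closed by (intro homI) (auto simp: idem_part_mult[OF reg] cancel_class_mult)
  moreover have "inj_on ?h (carrier G)"
  proof (rule inj_onI)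
    fix x y assume x: "x \<in> carrier G" and y: "y \<in> carrier G" and eq: "?h x = ?h y"
    define e where "e = idem_part x"
    have e: "e \<in> idempotents G" "x \<in> carrier (idem_group G e)" "y \<in> carrier (idem_group G e)"
      using p[OF x] p[OF y] eq by (auto simp: e_def)
    obtain f where f: "f \<in> idempotents G" "x \<otimes> f = y \<otimes> f"
      using eq cancel_class_eq_iff[OF x y] by auto
    have c: "e \<in> carrier G" "f \<in> carrier G" using e(1) f(1) idempotents_carrier by auto
    \<comment> \<open>The idempotent f that identifies x with y need not lie above e. Replacing it
      by e + f preserves the equation and brings the embedding condition into play.\<close>
    have "x \<otimes> (e \<otimes> f) = y \<otimes> (e \<otimes> f)"
      using x y c f(2) m_lcomm[of x e f] m_lcomm[of y e f] by simp
    moreover have "inj_on (\<lambda>x. x \<otimes> (e \<otimes> f)) (carrier (idem_group G e))"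
      using emb e(1) idempotents_mult[OF e(1) f(1)] alg_le_mult_left[OF c]
      unfolding embedding_condition_def by blast
    ultimately show "x = y" using e(2,3) by (auto dest: inj_onD)
  qed
  moreover have "?h ` carrier G = carrier ?S"
  proof
    show "?h ` carrier G \<subseteq> carrier ?S" using closed by blast
    show "carrier ?S \<subseteq> ?h ` carrier G"
    proof
      fix w assume "w \<in> carrier ?S"
      then obtain e x where w: "e \<in> idempotents G" "x \<in> carrier (idem_group G e)" "w = (e, cancel_class G x)"
        by (auto simp: cancel_subgroup_def)
      then have "w = ?h x" using idem_part_eq[OF w(1,2)] by simp
      then show "w \<in> ?h ` carrier G" using idem_group_carrier[OF w(2)] by blast
    qed
  qed
  ultimately show ?thesis by (simp add: iso_def bij_betw_def)
qed

end

section \<open>The representation theorem\<close>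

lemma (in semilattice_of_subgroups) semilattice_group_data_iff_iso:
  "semilattice_group_data M L G H \<longleftrightarrow> M \<cong> S"
  unfolding semilattice_group_data_def
  using semilattice_L G.comm_group_axioms subgroup_H mono_H carrier_G submonoid_S by blast

lemma semilattice_group_data_imp:
  assumes "semilattice_group_data M L G H"
  shows "semilattice_of_subgroups L G H"
proof -
  interpret L: comm_monoid L
    using assms by (simp add: semilattice_group_data_def semilattice_monoid_def)
  show ?thesis
    using assms L.comm_monoid_axioms L.alg_le_closed
    by (intro semilattice_of_subgroups.intro semilattice_of_subgroups_axioms.intro)
      (auto simp: semilattice_group_data_def semilattice_monoid_def)
qed

text \<open>Existence is witnessed over types built from \<open>'m\<close>, whereas the equivalences
  are asserted for all data over arbitrary types \<open>'l\<close> and \<open>'g\<close>, not only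
  for the constructed ones.\<close>

theorem theorem3p3:
  fixes M :: "('m, 'x) monoid_scheme"
  assumes "regular_monoid M" and "embedding_condition M"
  shows "(\<exists>(L :: 'm monoid) (G :: 'm set monoid) H. semilattice_group_data M L G H) \<and>
    (\<forall>(L :: 'l monoid) (G :: 'g monoid) H. semilattice_group_data M L G H \<longrightarrow>
      (refinement_monoid M \<longleftrightarrow>
         distributive_semilattice L \<and>
         (\<forall>e\<in>carrier L. \<forall>f\<in>carrier L. H e <#>\<^bsub>G\<^esub> H f = H (e \<otimes>\<^bsub>L\<^esub> f)) \<and>
         (\<forall>e\<in>carrier L. \<forall>f\<in>carrier L.
            H e \<inter> H f = (\<Union>g\<in>{g \<in> carrier L. alg_le L g e \<and> alg_le L g f}. H g))) \<and>
      (conical_monoid M \<longleftrightarrow> H \<one>\<^bsub>L\<^esub> = {\<one>\<^bsub>G\<^esub>}) \<and>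
      (purity_condition M \<longleftrightarrow> (\<forall>e\<in>carrier L. pure_subgroup (H e) G)))"
proof (intro conjI allI impI)
  interpret M: comm_monoid M using assms(1) by (simp add: regular_monoid_def)
  show "\<exists>(L :: 'm monoid) (G :: 'm set monoid) H. semilattice_group_data M L G H"
    using semilattice_of_subgroups.semilattice_group_data_iff_iso[OF
        M.semilattice_of_subgroups_idem[OF assms(1)]] is_isoI[OF M.iso_fibred_submonoid[OF assms]]
    by blast
  fix L :: "'l monoid" and G :: "'g monoid" and H
  assume data: "semilattice_group_data M L G H"
  interpret semilattice_of_subgroups L G H by (rule semilattice_group_data_imp[OF data])
  obtain h where "h \<in> iso M S"
    using data semilattice_group_data_iff_iso by (auto simp: is_iso_def)
  then interpret comm_monoid_iso M S h
    by unfold_locales (auto simp: iso_def)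
  show "refinement_monoid M \<longleftrightarrow>
         distributive_semilattice L \<and>
         (\<forall>e\<in>carrier L. \<forall>f\<in>carrier L. H e <#>\<^bsub>G\<^esub> H f = H (e \<otimes>\<^bsub>L\<^esub> f)) \<and>
         (\<forall>e\<in>carrier L. \<forall>f\<in>carrier L.
            H e \<inter> H f = (\<Union>g\<in>{g \<in> carrier L. alg_le L g e \<and> alg_le L g f}. H g))"
    unfolding refinement_transfer
    by (rule iffI, simp add: refinement_S_imp_distributive refinement_S_imp_set_mult refinement_S_imp_Int)
      (intro refinement_S; blast)
  show "conical_monoid M \<longleftrightarrow> H \<one>\<^bsub>L\<^esub> = {\<one>\<^bsub>G\<^esub>}"
    unfolding conical_transfer by (rule conical_S)
  show "purity_condition M \<longleftrightarrow> (\<forall>e\<in>carrier L. pure_subgroup (H e) G)"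
    unfolding purity_transfer by (rule purity_S)
qed

end
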